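(* Consider the complex-tetrad reduced vacuum field equations (context) with $\mathcal{A}(\psi)\equiv\alpha$ a nonzero constant, and arbitrary $\beta$, $\kappa$, $\tilde{\mathcal{C}}$, $\mathcal{V}$. Let $A,C,\psi$ be smooth functions on an open interval $I\subset(0,\infty)$ with $A,C$ nowhere zero, satisfying $E^{(2)}_{tt}=0$ and $E^{(2)}_{\vartheta\vartheta}=0$ on $I$. Then $$rA(A-rA')\,C'+C\big(C^2-A^2+r^2A'^2+r^2AA''\big)=0\quad\text{on } I .$$ In particular, if $C\equiv1$ then there exist constants $M,\Lambda$ with $A(r)^2=1-\frac{2M}{r}-\Lambda r^2$ on $I$, i.e. the metric is Schwarzschild–(anti-)de Sitter, for every choice of $\tilde{\mathcal{C}}$ and $\mathcal{V}$.
   Context: Metric ansatz ${\rm d}s^2=A(r)^2{\rm d}t^2-\frac{C(r)^2}{A(r)^2}{\rm d}r^2-r^2{\rm d}\Omega^2$, scalar field $\psi=\psi(r)$. Primes on $A,C,\psi$ are $r$-derivatives; $\mathcal{A}',\tilde{\mathcal{C}}',\tilde{\mathcal{C}}'',\mathcal{V}'$ are $\psi$-derivatives evaluated at $\psi(r)$. The complex-tetrad reduced vacuum field equations of the scalar-torsion theory are: $E^{(2)}_{tt}:\ 0=\mathcal{A}\frac{A^2(-2rACA'-A^2(C-2rC')+C^3)}{r^2C^3}+\tilde{\mathcal{C}}'\frac{A^3(C(A'\psi'+A\psi'')-AC'\psi')}{C^3}-\frac{2A^4\psi'\mathcal{A}'}{rC^2}+\frac{A^4\psi'^2\tilde{\mathcal{C}}''}{C^2}-\frac{\beta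 A^4\psi'^2}{2C^2}+\kappa^2A^2\mathcal{V}$; $E^{(2)}_{rr}:\ 0=\frac{\mathcal{A}(-2rAA'-A^2+C^2)}{r^2A^2}+\big(\frac{A'}{A}+\frac2r\big)\psi'\tilde{\mathcal{C}}'+\frac{\kappa^2C^2\mathcal{V}}{A^2}+\frac12\beta\psi'^2$; $E^{(2)}_{\vartheta\vartheta}:\ 0=-\mathcal{A}'\frac{A(rA'+A)\psi'}{rC^2}+\tilde{\mathcal{C}}'\frac{A(C(A'\psi'+A\psi'')-AC'\psi')}{C^3}+\frac{\mathcal{A}(-rCA'^2+A(rA'C'-C(rA''+2A'))+A^2C')}{rC^3}+\frac{A^2\psi'^2\tilde{\mathcal{C}}''}{C^2}-\frac{\beta A^2\psi'^2}{2C^2}+\kappa^2\mathcal{V}$; $E^{(2)}_{\psi}:\ 0=\frac{(2rAA'+A^2+C^2)\mathcal{A}'}{r^2C^2}+\frac{\beta A(2rCA'\psi'+A(C(r\psi''+2\psi')-rC'\psi'))}{rC^3}+\frac{\tilde{\mathcal{C}}'(r^2CA'^2+rA(C(rA''+6A')-rA'C')+2A^2(C-rC'))}{r^2C^3}+\kappa^2\mathcal{V}'$. *)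

theory Defs
  imports "HOL-Analysis.Analysis"
begin

definition smooth_on :: "real set \<Rightarrow> (real \<Rightarrow> real) \<Rightarrow> bool" where
  "smooth_on S f \<longleftrightarrow> (\<forall>n. \<forall>x\<in>S. ((deriv ^^ n) f) differentiable (at x))"

text \<open>Arguments: coupling functions Acal, Ct (tilde C),
  V of psi, constants beta, kappa; metric functions A, C and scalar field psi of r.
  Primes on A, C, psi are r-derivatives; primes on Acal, Ct, V are psi-derivatives
  evaluated at psi r.\<close>
definition E_tt ::
  "(real \<Rightarrow> real) \<Rightarrow> (real \<Rightarrow> real) \<Rightarrow> (real \<Rightarrow> real) \<Rightarrow> real \<Rightarrow> real \<Rightarrow>
   (real \<Rightarrow> real) \<Rightarrow> (real \<Rightarrow> real) \<Rightarrow> (real \<Rightarrow> real) \<Rightarrow> real \<Rightarrow> real" where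
  "E_tt Acal Ct V \<beta> \<kappa> A C \<psi> r =
    (let a = A r; a1 = deriv A r; c = C r; c1 = deriv C r;
         p1 = deriv \<psi> r; p2 = deriv (deriv \<psi>) r; p = \<psi> r
     in Acal p * (a^2 * (-2*r*a*c*a1 - a^2*(c - 2*r*c1) + c^3)) / (r^2 * c^3)
        + deriv Ct p * (a^3 * (c*(a1*p1 + a*p2) - a*c1*p1)) / c^3
        - 2 * a^4 * p1 * deriv Acal p / (r * c^2)
        + a^4 * p1^2 * deriv (deriv Ct) p / c^2
        - \<beta> * a^4 * p1^2 / (2 * c^2)
        + \<kappa>^2 * a^2 * V p)"

definition E_thth ::
  "(real \<Rightarrow> real) \<Rightarrow> (real \<Rightarrow> real) \<Rightarrow> (real \<Rightarrow> real) \<Rightarrow> real \<Rightarrow> real \<Rightarrow>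
   (real \<Rightarrow> real) \<Rightarrow> (real \<Rightarrow> real) \<Rightarrow> (real \<Rightarrow> real) \<Rightarrow> real \<Rightarrow> real" where
  "E_thth Acal Ct V \<beta> \<kappa> A C \<psi> r =
    (let a = A r; a1 = deriv A r; a2 = deriv (deriv A) r; c = C r; c1 = deriv C r;
         p1 = deriv \<psi> r; p2 = deriv (deriv \<psi>) r; p = \<psi> r
     in - deriv Acal p * (a * (r*a1 + a) * p1) / (r * c^2)
        + deriv Ct p * (a * (c*(a1*p1 + a*p2) - a*c1*p1)) / c^3
        + Acal p * (- r*c*a1^2 + a*(r*a1*c1 - c*(r*a2 + 2*a1)) + a^2*c1) / (r * c^3)
        + a^2 * p1^2 * deriv (deriv Ct) p / c^2
        - \<beta> * a^2 * p1^2 / (2 * c^2)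
        + \<kappa>^2 * V p)"

end

theory Submission
  imports Defs
begin

text \<open>For constant \<open>\<A> = \<alpha>\<close> every term of \<open>E\<^sub>t\<^sub>t\<close> except the \<open>\<A>\<close>-term is \<open>A\<^sup>2\<close> times the
  corresponding term of \<open>E\<^sub>\<vartheta>\<^sub>\<vartheta>\<close>, so the combination \<open>E\<^sub>t\<^sub>t - A\<^sup>2 E\<^sub>\<vartheta>\<^sub>\<vartheta>\<close> eliminates
  \<open>\<psi>\<close>, \<open>\<beta>\<close>, \<open>\<C>\<close> and \<open>\<V>\<close> and leaves a constraint on the metric alone.
  With \<open>C = 1\<close> that constraint says \<open>r\<^sup>2 w'' = 2 w\<close> for \<open>w = A\<^sup>2 - 1\<close>, an Euler equation
  with fundamental solutions \<open>r\<^sup>2\<close> and \<open>1/r\<close>.\<close>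

definition metric_constraint :: "(real \<Rightarrow> real) \<Rightarrow> (real \<Rightarrow> real) \<Rightarrow> real \<Rightarrow> real" where
  "metric_constraint A C r =
     r * A r * (A r - r * deriv A r) * deriv C r
     + C r * ((C r)^2 - (A r)^2 + r^2 * (deriv A r)^2 + r^2 * A r * deriv (deriv A) r)"

lemma E_tt_minus_E_thth_const_coupling:
  assumes "\<And>x. Acal x = \<alpha>" and "r \<noteq> 0" and "C r \<noteq> 0"
  shows "E_tt Acal Ct V \<beta> \<kappa> A C \<psi> r - (A r)^2 * E_thth Acal Ct V \<beta> \<kappa> A C \<psi> r
           = \<alpha> * (A r)^2 * metric_constraint A C r / (r^2 * (C r)^3)"
proof -
  have "Acal = (\<lambda>_. \<alpha>)" using assms(1) by blast
  then have "deriv Acal x = 0" for x by simp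
  then have "E_tt Acal Ct V \<beta> \<kappa> A C \<psi> r - (A r)^2 * E_thth Acal Ct V \<beta> \<kappa> A C \<psi> r
     = \<alpha> * ((A r)^2 * (-2*r*A r*C r*deriv A r - (A r)^2*(C r - 2*r*deriv C r) + (C r)^3) / (r^2 * (C r)^3)
        - (A r)^2 * ((- r*C r*(deriv A r)^2 + A r*(r*deriv A r*deriv C r - C r*(r*deriv (deriv A) r + 2*deriv A r)) + (A r)^2*deriv C r) / (r * (C r)^3)))"
    using assms unfolding E_tt_def E_thth_def Let_def
    by (simp add: algebra_simps power2_eq_square power3_eq_cube power4_eq_xxxx)
  also have "\<dots> = \<alpha> * (A r)^2 * metric_constraint A C r / (r^2 * (C r)^3)"
    using assms(2,3) unfolding metric_constraint_def
    by (simp add: field_simps power2_eq_square power3_eq_cube)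
  finally show ?thesis .
qed

lemma euler_equation_solutions:
  fixes w w' w'' :: "real \<Rightarrow> real" and I :: "real set"
  assumes "is_interval I" and "I \<subseteq> {0<..}"
    and "\<And>r. r \<in> I \<Longrightarrow> (w has_real_derivative w' r) (at r)"
    and "\<And>r. r \<in> I \<Longrightarrow> (w' has_real_derivative w'' r) (at r)"
    and "\<And>r. r \<in> I \<Longrightarrow> r^2 * w'' r = 2 * w r"
  shows "\<exists>a b. \<forall>r\<in>I. w r = a * r^2 + b / r"
proof -
  have conv: "convex I" using assms(1) by (simp add: is_interval_convex_1)
  text \<open>The Wronskians of \<open>w\<close> with the fundamental solutions \<open>1/r\<close> and \<open>r\<^sup>2\<close> are constant.\<close>
  obtain p where p: "\<forall>r\<in>I. (r * w' r + w r) / r^2 = p"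
  proof (atomize_elim, rule has_field_derivative_zero_constant[OF conv])
    fix r assume r: "r \<in> I"
    then have "r > 0" using assms(2) by auto
    have "((\<lambda>r. (r * w' r + w r) / r^2) has_real_derivative
            ((w' r + r * w'' r + w' r) * r^2 - (r * w' r + w r) * (2 * r)) / (r^2)^2) (at r)"
      using assms(3,4)[OF r] \<open>r > 0\<close> by (auto intro!: derivative_eq_intros)
    moreover have "(w' r + r * w'' r + w' r) * r^2 - (r * w' r + w r) * (2 * r) = 0"
      using arg_cong[OF assms(5)[OF r], of "\<lambda>x. r * x"]
      by (simp add: algebra_simps power2_eq_square)
    ultimately show "((\<lambda>r. (r * w' r + w r) / r^2) has_real_derivative 0) (at r within I)"
      by (simp add: has_field_derivative_at_within)
  qed
  obtain q where q: "\<forall>r\<in>I. r * (r * w' r - 2 * w r) = q"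
  proof (atomize_elim, rule has_field_derivative_zero_constant[OF conv])
    fix r assume r: "r \<in> I"
    have "((\<lambda>r. r * (r * w' r - 2 * w r)) has_real_derivative
            (r * w' r - 2 * w r) + r * (w' r + r * w'' r - 2 * w' r)) (at r)"
      using assms(3,4)[OF r] by (auto intro!: derivative_eq_intros)
    moreover have "(r * w' r - 2 * w r) + r * (w' r + r * w'' r - 2 * w' r) = 0"
      using assms(5)[OF r] by (simp add: algebra_simps power2_eq_square)
    ultimately show "((\<lambda>r. r * (r * w' r - 2 * w r)) has_real_derivative 0) (at r within I)"
      by (simp add: has_field_derivative_at_within)
  qed
  have "w r = p / 3 * r^2 + (- q / 3) / r" if r: "r \<in> I" for r
  proof -
    have "r > 0" using r assms(2) by auto
    have "r * w' r + w r = p * r^2" and "r * (r * w' r - 2 * w r) = q"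
      using p q r \<open>r > 0\<close> by (auto simp: field_simps)
    then have "r * (r * w' r + w r) - r * (r * w' r - 2 * w r) = r * (p * r^2) - q"
      by simp
    then have "3 * r * w r = p * r^3 - q"
      by (simp add: algebra_simps power2_eq_square power3_eq_cube)
    then show ?thesis using \<open>r > 0\<close>
      by (simp add: field_simps power2_eq_square power3_eq_cube)
  qed
  then show ?thesis by blast
qed

lemma smooth_on_has_derivatives:
  assumes "smooth_on I f" and "x \<in> I"
  shows "(f has_real_derivative deriv f x) (at x)"
    and "(deriv f has_real_derivative deriv (deriv f) x) (at x)"
proof -
  have "((deriv ^^ n) f) differentiable (at x)" for n
    using assms unfolding smooth_on_def by blast
  from this[of 0] this[of 1]
  show "(f has_real_derivative deriv f x) (at x)"
    and "(deriv f has_real_derivative deriv (deriv f) x) (at x)"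
    by (simp_all add: DERIV_deriv_iff_real_differentiable)
qed

lemma schwarzschild_de_sitter_of_metric_constraint:
  assumes "is_interval I" and "open I" and "I \<subseteq> {0<..}" and "smooth_on I A"
    and "\<And>r. r \<in> I \<Longrightarrow> C r = 1"
    and "\<And>r. r \<in> I \<Longrightarrow> metric_constraint A C r = 0"
  shows "\<exists>M \<Lambda>. \<forall>r\<in>I. (A r)^2 = 1 - 2 * M / r - \<Lambda> * r^2"
proof -
  have "deriv C r = 0" if r: "r \<in> I" for r
  proof (rule DERIV_imp_deriv)
    show "(C has_real_derivative 0) (at r)"
      by (rule has_field_derivative_transform_within_open[of "\<lambda>_. 1" _ _ I])
        (use assms(2,5) r in auto)
  qed
  then have euler: "r^2 * (2 * (deriv A r)^2 + 2 * A r * deriv (deriv A) r) = 2 * ((A r)^2 - 1)"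
    if r: "r \<in> I" for r
    using assms(5,6)[OF r] r unfolding metric_constraint_def by (simp add: algebra_simps)
  obtain a b where "\<forall>r\<in>I. (A r)^2 - 1 = a * r^2 + b / r"
  proof (atomize_elim, rule euler_equation_solutions[OF assms(1,3) _ _ euler])
    fix r assume r: "r \<in> I"
    note A' = smooth_on_has_derivatives[OF assms(4) r]
    show "((\<lambda>r. (A r)^2 - 1) has_real_derivative 2 * A r * deriv A r) (at r)"
      using A' by (auto intro!: derivative_eq_intros)
    show "((\<lambda>r. 2 * A r * deriv A r) has_real_derivative
            2 * (deriv A r)^2 + 2 * A r * deriv (deriv A) r) (at r)"
      using A' by (auto intro!: derivative_eq_intros simp: power2_eq_square)
  qed
  then have "\<forall>r\<in>I. (A r)^2 = 1 - 2 * (- b / 2) / r - (- a) * r^2"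
    by (simp add: algebra_simps)
  then show ?thesis by blast
qed

theorem mainTheorem2:
  fixes Acal Ct V :: "real \<Rightarrow> real" and \<alpha> \<beta> \<kappa> :: real
    and A C \<psi> :: "real \<Rightarrow> real" and I :: "real set"
  assumes Aconst: "\<And>x. Acal x = \<alpha>" and alpha_nz: "\<alpha> \<noteq> 0"
    and Ct_smooth: "smooth_on UNIV Ct" and V_smooth: "smooth_on UNIV V"
    and I_open: "open I" and I_interval: "is_interval I" and I_ne: "I \<noteq> {}"
    and I_pos: "I \<subseteq> {0<..}"
    and A_smooth: "smooth_on I A" and C_smooth: "smooth_on I C"
    and psi_smooth: "smooth_on I \<psi>"
    and A_nz: "\<And>r. r \<in> I \<Longrightarrow> A r \<noteq> 0" and C_nz: "\<And>r. r \<in> I \<Longrightarrow> C r \<noteq> 0"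
    and Ett: "\<And>r. r \<in> I \<Longrightarrow> E_tt Acal Ct V \<beta> \<kappa> A C \<psi> r = 0"
    and Ethth: "\<And>r. r \<in> I \<Longrightarrow> E_thth Acal Ct V \<beta> \<kappa> A C \<psi> r = 0"
  shows "(\<forall>r\<in>I. r * A r * (A r - r * deriv A r) * deriv C r
              + C r * ((C r)^2 - (A r)^2 + r^2 * (deriv A r)^2
                       + r^2 * A r * deriv (deriv A) r) = 0)
         \<and> ((\<forall>r\<in>I. C r = 1) \<longrightarrow>
              (\<exists>M \<Lambda> :: real. \<forall>r\<in>I. (A r)^2 = 1 - 2 * M / r - \<Lambda> * r^2))"
proof -
  have constraint: "metric_constraint A C r = 0" if r: "r \<in> I" for r
  proof -
    have "r > 0" using r I_pos by auto
    have "\<alpha> * (A r)^2 * metric_constraint A C r / (r^2 * (C r)^3) = 0"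
      using E_tt_minus_E_thth_const_coupling[where Acal = Acal and Ct = Ct and V = V
          and \<beta> = \<beta> and \<kappa> = \<kappa> and A = A and C = C and \<psi> = \<psi> and r = r, OF Aconst]
        Ett[OF r] Ethth[OF r] \<open>r > 0\<close> C_nz[OF r]
      by simp
    then show ?thesis using alpha_nz A_nz[OF r] C_nz[OF r] \<open>r > 0\<close> by simp
  qed
  show ?thesis
    using constraint schwarzschild_de_sitter_of_metric_constraint[OF I_interval I_open I_pos A_smooth]
    unfolding metric_constraint_def by blast
qed

end
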